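(* If $\Pi$ and $\Gamma$ are two tournaments on a finite set $I$ with the same scores, then the minimum number of $3$-cycle reversal steps needed to get from $\Gamma$ to $\Pi$ is $\beta(\Delta(\Gamma,\Pi))$.
   Context: A tournament on $I$ is a relation $\Pi\subset I\times I$ without loops such that for distinct $i,j$ exactly one of $(i,j),(j,i)$ is in $\Pi$. $\Pi(i)=\{j:(i,j)\in\Pi\}$. Tournaments $\Pi,\Gamma$ on $I$ have the same scores if $|\Pi(i)|=|\Gamma(i)|$ for all $i\in I$. Define $\Delta(\Gamma,\Pi) = \{(i,j)\in\Gamma : (j,i)\in\Pi\}$; when the scores agree this is Eulerian (each vertex has as many inputs as outputs in it). A $k$-cycle ($k\ge3$) is a digraph $\{(i_1,i_2),\dots,(i_{k-1},i_k),(i_k,i_1)\}$ with $i_1,\dots,i_k$ distinct. A $3$-cycle reversal step replaces a tournament $\Gamma$ by $(\Gamma\setminus C)\cup C^{-1}$ for some $3$-cycle $C\subset\Gamma$, where $C^{-1}=\{(j,i):(i,j)\in C\}$. For an Eulerian digraph $\Delta$, the span $\sigma(\Delta)$ is the maximum cardinality of a set of pairwise edge-disjoint cycles with union $\Delta$ ($\sigma(\emptyset)=0$), and $\beta(\Delta)=|\Delta|-2\sigma(\Delta)$, where $|\Delta|$ is the number of edges. *)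

theory Defs
  imports Main
begin

text \<open>Digraphs are identified with their edge sets.\<close>

definition tournament :: "'a set \<Rightarrow> 'a rel \<Rightarrow> bool" where
  "tournament I P \<longleftrightarrow>
     P \<subseteq> I \<times> I \<and> irrefl P \<and>
     (\<forall>i\<in>I. \<forall>j\<in>I. i \<noteq> j \<longrightarrow> ((i, j) \<in> P) \<noteq> ((j, i) \<in> P))"

definition same_scores :: "'a set \<Rightarrow> 'a rel \<Rightarrow> 'a rel \<Rightarrow> bool" where
  "same_scores I P G \<longleftrightarrow> (\<forall>i\<in>I. card (P `` {i}) = card (G `` {i}))"

definition diff_digraph :: "'a rel \<Rightarrow> 'a rel \<Rightarrow> 'a rel" where
  "diff_digraph G P = {(i, j). (i, j) \<in> G \<and> (j, i) \<in> P}"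

definition k_cycle :: "nat \<Rightarrow> 'a rel \<Rightarrow> bool" where
  "k_cycle k C \<longleftrightarrow>
     k \<ge> 3 \<and>
     (\<exists>xs. length xs = k \<and> distinct xs \<and> C = {(xs ! i, xs ! (Suc i mod k)) |i. i < k})"

definition reversal_step :: "'a set \<Rightarrow> 'a rel rel" where
  "reversal_step I =
     {(G, G'). tournament I G \<and> (\<exists>C. k_cycle 3 C \<and> C \<subseteq> G \<and> G' = (G - C) \<union> C\<inverse>)}"

definition cycle_decomposition :: "'a rel \<Rightarrow> 'a rel set \<Rightarrow> bool" where
  "cycle_decomposition D F \<longleftrightarrow>
     (\<forall>C\<in>F. \<exists>k. k_cycle k C) \<and> pairwise disjnt F \<and> \<Union>F = D"

text \<open>
  Meaningful for finite digraphs that have a cycle decomposition, i.e. finite Eulerian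
  digraphs without loops and without pairs of opposite edges; otherwise the value of
  \<open>Max\<close> is unspecified.
\<close>
definition eulerian_span :: "'a rel \<Rightarrow> nat" where
  "eulerian_span D = Max {card F |F. cycle_decomposition D F}"

text \<open>Integer-valued, so that the subtraction is not truncated.\<close>
definition beta :: "'a rel \<Rightarrow> int" where
  "beta D = int (card D) - 2 * int (eulerian_span D)"

lemma eulerian_span_empty: "eulerian_span {} = 0"
proof -
  have "\<not> k_cycle k {}" for k :: nat
    by (auto simp: k_cycle_def intro!: exI[of _ 0])
  then have "cycle_decomposition {} F \<longleftrightarrow> F = {}" for F :: "'a rel set"
    unfolding cycle_decomposition_def Union_empty_conv by (metis empty_iff equals0I pairwise_empty)
  then show ?thesis
    by (simp add: eulerian_span_def)
qed

end

theory Submission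
  imports Defs
begin

text \<open>
  Upper bound: a $k$-cycle is reversed by $k-2$ steps, splitting off a triangle along a chord, so a
  decomposition of $\Delta(\Gamma,\Pi)$ into $\sigma$ cycles costs $|\Delta| - 2\sigma$ steps.
  Lower bound: a step lowers $\beta$ by at most one. If reversing the triangle $C$ turns $\Delta$
  into $\Delta'$, drop from an optimal decomposition of $\Delta'$ the at most $3 - |C \cap \Delta|$
  cycles that meet $C^{-1}$. The others lie in $\Delta$, and what they miss of $\Delta$ is Eulerian,
  so it contributes another cycle unless it is empty; in that case $C \cap \Delta = \emptyset$ and
  the only cycle dropped is $C^{-1}$.
\<close>

section \<open>Cycles\<close>

text \<open>Since \<open>rotate1\<close> shifts the list by one place, zipping pairs every vertex
  with its cyclic successor. This form unfolds edge by edge on a list \<open>a # b # c # zs\<close>,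
  which the induction reversing a long cycle relies on; the indexed form suits counting
  neighbours.\<close>

lemma k_cycle_iff_zip:
  "k_cycle k C \<longleftrightarrow>
     k \<ge> 3 \<and> (\<exists>xs. length xs = k \<and> distinct xs \<and> C = set (zip xs (rotate1 xs)))"
proof -
  have "{(xs ! i, xs ! (Suc i mod length xs)) |i. i < length xs} = set (zip xs (rotate1 xs))"
    for xs :: "'a list"
    by (auto simp: set_zip nth_rotate1)
  then show ?thesis
    unfolding k_cycle_def by auto
qed

lemma k_cycleE:
  assumes "k_cycle k C"
  obtains xs where "k \<ge> 3" "length xs = k" "distinct xs" "C = set (zip xs (rotate1 xs))"
  using assms unfolding k_cycle_iff_zip by blast

lemma k_cycle_finite: "k_cycle k C \<Longrightarrow> finite C"
  by (auto elim: k_cycleE)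

lemma k_cycle_card:
  assumes "k_cycle k C"
  shows "card C = k"
  using assms by (auto elim!: k_cycleE simp: distinct_card distinct_zipI1)

lemma k_cycle_nonempty: "k_cycle k C \<Longrightarrow> C \<noteq> {}"
  using k_cycle_card[of k C] by (auto simp: k_cycle_def)

section \<open>Eulerian digraphs\<close>

text \<open>The two images are the out- and in-neighbours of \<open>v\<close>. Finiteness is built
  in because \<open>card\<close> is 0 on infinite sets, where equal cardinalities would say nothing
  about degrees.\<close>

definition eulerian :: "'a rel \<Rightarrow> bool" where
  "eulerian D \<longleftrightarrow> finite D \<and> (\<forall>v. card (D `` {v}) = card (D\<inverse> `` {v}))"

lemma card_Image_Diff:
  assumes "finite D" "E \<subseteq> D"
  shows "card ((D - E) `` {v}) = card (D `` {v}) - card (E `` {v})"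
proof -
  have "(D - E) `` {v} = D `` {v} - E `` {v}" by auto
  moreover have "finite (E `` {v})"
    using assms by (meson finite_Image finite_subset)
  ultimately show ?thesis
    using assms by (simp add: card_Diff_subset Image_mono)
qed

lemma eulerian_Diff:
  assumes "eulerian D" "eulerian E" "E \<subseteq> D"
  shows "eulerian (D - E)"
proof -
  have "(D - E)\<inverse> = D\<inverse> - E\<inverse>" by auto
  with assms show ?thesis
    by (simp add: eulerian_def card_Image_Diff)
qed

lemma card_Image_Un:
  assumes "finite D" "finite E" "D \<inter> E = {}"
  shows "card ((D \<union> E) `` {v}) = card (D `` {v}) + card (E `` {v})"
proof -
  have "(D \<union> E) `` {v} = D `` {v} \<union> E `` {v}" by auto
  moreover have "D `` {v} \<inter> E `` {v} = {}" using assms by auto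
  ultimately show ?thesis
    using assms by (simp add: card_Un_disjoint finite_Image)
qed

lemma eulerian_Un:
  assumes "eulerian D" "eulerian E" "D \<inter> E = {}"
  shows "eulerian (D \<union> E)"
proof -
  have "D\<inverse> \<inter> E\<inverse> = {}" using assms by auto
  with assms show ?thesis
    by (simp add: eulerian_def card_Image_Un converse_Un)
qed

text \<open>A vertex on the cycle has exactly one successor and one predecessor, because the listed
  vertices are distinct; any other vertex has neither.\<close>

lemma eulerian_k_cycle:
  assumes "k_cycle k C"
  shows "eulerian C"
proof -
  obtain xs where xs: "k \<ge> 3" "length xs = k" "distinct xs"
    and C: "C = {(xs ! i, xs ! (Suc i mod k)) |i. i < k}"
    using assms unfolding k_cycle_def by blast
  have "card (C `` {v}) = card (C\<inverse> `` {v})" for v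
  proof (cases "v \<in> set xs")
    case False
    have "xs ! (Suc i mod k) \<in> set xs" for i
      using xs by (intro nth_mem) simp
    with False C xs(2) have "C `` {v} = {}" "C\<inverse> `` {v} = {}"
      by auto
    then show ?thesis by simp
  next
    case True
    then obtain i where i: "i < k" "v = xs ! i"
      using xs by (metis in_set_conv_nth)
    \<comment> \<open>\<open>p\<close> is the cyclic predecessor of the index \<open>i\<close>, so
      it wraps around to \<open>k - 1\<close> when \<open>i = 0\<close>.\<close>
    obtain p where p: "p < k" "\<And>j. j < k \<Longrightarrow> Suc j mod k = i \<longleftrightarrow> j = p"
    proof
      show "(if i = 0 then k else i) - 1 < k" using i by auto
      show "Suc j mod k = i \<longleftrightarrow> j = (if i = 0 then k else i) - 1" if "j < k" for j
        using that i xs by (cases "Suc j = k") auto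
    qed
    have "C `` {v} = {xs ! (Suc i mod k)}"
      using C i xs by (auto simp: nth_eq_iff_index_eq)
    moreover have "C\<inverse> `` {v} = {xs ! p}"
    proof -
      have "xs ! (Suc j mod k) = xs ! i \<longleftrightarrow> Suc j mod k = i" for j
        using nth_eq_iff_index_eq[OF xs(3), of "Suc j mod k" i] i xs by simp
      then have "C\<inverse> `` {v} = {xs ! j |j. j < k \<and> Suc j mod k = i}"
        unfolding C i(2) by (auto; metis)
      also have "\<dots> = {xs ! p}"
        using p by blast
      finally show ?thesis .
    qed
    ultimately show ?thesis by simp
  qed
  then show ?thesis
    using assms by (simp add: eulerian_def k_cycle_finite)
qed

lemma eulerian_Union:
  assumes "finite F" "pairwise disjnt F" "\<And>C. C \<in> F \<Longrightarrow> eulerian C"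
  shows "eulerian (\<Union>F)"
  using assms
proof (induction F rule: finite_induct)
  case empty
  then show ?case by (simp add: eulerian_def)
next
  case (insert C F)
  then have "C \<inter> \<Union>F = {}"
    by (auto simp: pairwise_insert disjnt_def)
  with insert show ?case
    by (auto simp: pairwise_insert intro!: eulerian_Un)
qed

text \<open>A vertex that can be entered can also be left, so following a chosen successor
  \<open>f\<close> never gets stuck. The walk stays in the finite set \<open>Range D\<close> and
  must revisit a vertex; a shortest closed walk of this kind is a cycle. Asymmetry rules out the
  lengths 1 and 2.\<close>

lemma eulerian_contains_cycle:
  assumes "eulerian D" "asym D" "D \<noteq> {}"
  shows "\<exists>k C. k_cycle k C \<and> C \<subseteq> D"
proof -
  have fin: "finite D" using assms by (simp add: eulerian_def)
  have "\<exists>w. (v, w) \<in> D" if "v \<in> Range D" for v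
  proof -
    have "card (D\<inverse> `` {v}) \<noteq> 0"
      using that fin by (auto simp: card_eq_0_iff finite_Image)
    then have "card (D `` {v}) \<noteq> 0"
      using assms(1) unfolding eulerian_def by metis
    then have "D `` {v} \<noteq> {}" by force
    then show ?thesis by auto
  qed
  then obtain f where f: "\<And>v. v \<in> Range D \<Longrightarrow> (v, f v) \<in> D"
    by metis
  obtain v where v: "v \<in> Range D" using assms by auto
  have iter: "(f ^^ n) w \<in> Range D" if "w \<in> Range D" for n w
    using that f by (induction n) auto
  \<comment> \<open>The period is minimised over all starting points \<open>w\<close>, not only over
    \<open>v\<close>. A repetition inside the shortest closed walk would then be a shorter period
    starting at an intermediate vertex, which minimality forbids.\<close>
  let ?P = "\<lambda>p. p > 0 \<and> (\<exists>w\<in>Range D. (f ^^ p) w = w)"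
  have "\<not> inj (\<lambda>n. (f ^^ n) v)"
  proof
    assume "inj (\<lambda>n. (f ^^ n) v)"
    then have "infinite (range (\<lambda>n. (f ^^ n) v))"
      using finite_imageD by blast
    moreover have "range (\<lambda>n. (f ^^ n) v) \<subseteq> Range D"
      using iter v by auto
    ultimately show False
      using fin finite_subset finite_Range by metis
  qed
  then obtain m n where mn: "m < n" "(f ^^ m) v = (f ^^ n) v"
    by (metis (lifting) injI linorder_neqE_nat)
  have shift: "(f ^^ (j - i)) ((f ^^ i) w) = (f ^^ j) w" if "i \<le> j" for i j w
    using that by (metis comp_apply funpow_add le_add_diff_inverse2)
  have "?P (n - m)"
    using mn shift[of m n v] iter[OF v, of m] by auto
  define p where "p = (LEAST q. ?P q)"
  have min: "\<not> ?P q" if "q < p" for q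
    using that unfolding p_def by (rule not_less_Least)
  have p: "?P p"
    unfolding p_def by (rule LeastI) fact
  then obtain w where w: "w \<in> Range D" "(f ^^ p) w = w" by blast
  define xs where "xs = map (\<lambda>i. (f ^^ i) w) [0..<p]"
  have "p \<noteq> 1"
    using f[OF w(1)] w(2) asymD[OF assms(2), of w w] by auto
  moreover have "p \<noteq> 2"
    using f[OF w(1)] f[OF iter[OF w(1), of 1]] w(2) asymD[OF assms(2), of w "f w"]
    by (auto simp: numeral_2_eq_2)
  ultimately have "p \<ge> 3" using p by linarith
  moreover have "inj_on (\<lambda>i. (f ^^ i) w) {0..<p}"
  proof (rule linorder_inj_onI')
    fix i j assume ij: "i \<in> {0..<p}" "j \<in> {0..<p}" "i < j"
    have "\<not> ?P (j - i)" using ij by (intro min) auto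
    then have "(f ^^ (j - i)) ((f ^^ i) w) \<noteq> (f ^^ i) w"
      using ij iter[OF w(1), of i] by force
    with ij shift[of i j w] show "(f ^^ i) w \<noteq> (f ^^ j) w"
      by simp
  qed
  then have "distinct xs" by (simp add: xs_def distinct_map)
  moreover have "length xs = p" by (simp add: xs_def)
  ultimately have "k_cycle p {(xs ! i, xs ! (Suc i mod p)) |i. i < p}"
    unfolding k_cycle_def by blast
  moreover have "(xs ! i, xs ! (Suc i mod p)) \<in> D" if "i < p" for i
  proof -
    have "xs ! (Suc i mod p) = f (xs ! i)"
      using that w(2) by (cases "Suc i = p") (auto simp: xs_def)
    with that f iter[OF w(1)] show ?thesis by (simp add: xs_def)
  qed
  then have "{(xs ! i, xs ! (Suc i mod p)) |i. i < p} \<subseteq> D" by blast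
  ultimately show ?thesis by blast
qed

section \<open>Cycle decompositions and the span\<close>

text \<open>The second claim is what allows the numbers of cycles to be added. It rests on cycles
  being nonempty: disjoint edge sets alone would still let both families contain the empty
  set.\<close>

lemma cycle_decomposition_Un:
  assumes "cycle_decomposition D F" "cycle_decomposition E H" "D \<inter> E = {}"
  shows "cycle_decomposition (D \<union> E) (F \<union> H)" "F \<inter> H = {}"
proof -
  have sub: "C \<subseteq> D" if "C \<in> F" for C
    using that assms by (auto simp: cycle_decomposition_def)
  have sub': "C \<subseteq> E" if "C \<in> H" for C
    using that assms by (auto simp: cycle_decomposition_def)
  have cross: "disjnt A B" "disjnt B A" if "A \<in> F" "B \<in> H" for A B
    using sub[OF that(1)] sub'[OF that(2)] assms(3) by (auto simp: disjnt_def)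
  then show "cycle_decomposition (D \<union> E) (F \<union> H)"
    using assms unfolding cycle_decomposition_def pairwise_def by auto
  show "F \<inter> H = {}"
    using cross(1) assms k_cycle_nonempty
    unfolding cycle_decomposition_def disjnt_def by fastforce
qed

lemma cycle_decomposition_singleton: "k_cycle k C \<Longrightarrow> cycle_decomposition C {C}"
  by (auto simp: cycle_decomposition_def)

lemma cycle_decomposition_finite:
  assumes "cycle_decomposition D F" "finite D"
  shows "finite F"
  using assms by (auto simp: cycle_decomposition_def intro: finite_UnionD)

lemma cycle_decomposition_eulerian:
  assumes "cycle_decomposition D F" "finite F"
  shows "eulerian D"
proof -
  have "eulerian C" if "C \<in> F" for C
    using that assms eulerian_k_cycle unfolding cycle_decomposition_def by blast
  then show ?thesis
    using assms eulerian_Union[of F] unfolding cycle_decomposition_def by blast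
qed

text \<open>Removing a cycle leaves a smaller digraph that is again Eulerian and asymmetric, so
  cycles can be split off until no edge remains.\<close>

lemma cycle_decomposition_exists:
  assumes "eulerian D" "asym D"
  shows "\<exists>F. cycle_decomposition D F"
  using assms
proof (induction "card D" arbitrary: D rule: less_induct)
  case less
  show ?case
  proof (cases "D = {}")
    case True
    then show ?thesis by (auto simp: cycle_decomposition_def intro: exI[of _ "{}"])
  next
    case False
    then obtain k C where C: "k_cycle k C" "C \<subseteq> D"
      using eulerian_contains_cycle less by blast
    have "eulerian (D - C)"
      using eulerian_Diff[OF less.prems(1) eulerian_k_cycle[OF C(1)] C(2)] .
    moreover have "asym (D - C)"
      using less.prems(2) by (meson Diff_subset asym_on_subset asymD asymI subsetD)
    moreover have "D - C \<subset> D"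
      using C k_cycle_nonempty by blast
    then have "card (D - C) < card D"
      using less by (auto simp: eulerian_def intro: psubset_card_mono)
    ultimately obtain F where "cycle_decomposition (D - C) F"
      using less by blast
    from cycle_decomposition_Un(1)[OF this cycle_decomposition_singleton[OF C(1)]]
    have "cycle_decomposition (D - C \<union> C) (F \<union> {C})" by blast
    moreover have "D - C \<union> C = D" using C(2) by blast
    ultimately show ?thesis by metis
  qed
qed

text \<open>Together with the existence of a decomposition, this makes the \<open>Max\<close> in
  \<open>eulerian_span\<close> a genuine maximum.\<close>

lemma finite_cycle_decomposition_cards:
  assumes "finite D"
  shows "finite {card F |F. cycle_decomposition D F}"
proof -
  have "{F. cycle_decomposition D F} \<subseteq> Pow (Pow D)"
    by (auto simp: cycle_decomposition_def)
  then have "finite {F. cycle_decomposition D F}"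
    using assms by (meson finite_Pow_iff finite_subset)
  then show ?thesis by simp
qed

lemma card_le_eulerian_span:
  assumes "finite D" "cycle_decomposition D F"
  shows "card F \<le> eulerian_span D"
  unfolding eulerian_span_def
  using finite_cycle_decomposition_cards[OF assms(1)] assms(2) by (intro Max_ge) auto

lemma eulerian_span_attained:
  assumes "eulerian D" "asym D"
  obtains F where "cycle_decomposition D F" "card F = eulerian_span D"
proof -
  have "Max {card F |F. cycle_decomposition D F} \<in> {card F |F. cycle_decomposition D F}"
    using finite_cycle_decomposition_cards cycle_decomposition_exists assms
    by (intro Max_in) (auto simp: eulerian_def)
  then show thesis
    using that unfolding eulerian_span_def by auto
qed

section \<open>Reversals in tournaments\<close>

lemma tournament_edgeD:
  assumes "tournament I G" "(x, y) \<in> G"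
  shows "x \<in> I" "y \<in> I" "x \<noteq> y"
  using assms by (auto simp: tournament_def irrefl_def)

lemma tournament_iff:
  assumes "tournament I G" "x \<in> I" "y \<in> I" "x \<noteq> y"
  shows "(x, y) \<in> G \<longleftrightarrow> (y, x) \<notin> G"
  using assms unfolding tournament_def by blast

lemma tournament_asym: "tournament I G \<Longrightarrow> asym G"
  by (rule asymI) (metis tournament_iff tournament_edgeD)

lemma tournament_finite: "finite I \<Longrightarrow> tournament I G \<Longrightarrow> finite G"
  unfolding tournament_def by (meson finite_SigmaI finite_subset)

lemma tournament_reverse:
  assumes "tournament I G" "D \<subseteq> G"
  shows "tournament I (G - D \<union> D\<inverse>)"
  unfolding tournament_def
proof (intro conjI ballI impI)
  show "G - D \<union> D\<inverse> \<subseteq> I \<times> I"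
    using assms(2) tournament_edgeD(1,2)[OF assms(1)] by auto
  show "irrefl (G - D \<union> D\<inverse>)"
    using assms(2) tournament_edgeD(3)[OF assms(1)] unfolding irrefl_def by blast
  show "((i, j) \<in> G - D \<union> D\<inverse>) \<noteq> ((j, i) \<in> G - D \<union> D\<inverse>)"
    if "i \<in> I" "j \<in> I" "i \<noteq> j" for i j
    using tournament_iff[OF assms(1) that] assms(2) by blast
qed

lemma reversal_stepD:
  assumes "(G, G') \<in> reversal_step I"
  obtains C where "tournament I G" "k_cycle 3 C" "C \<subseteq> G" "G' = G - C \<union> C\<inverse>"
  using assms unfolding reversal_step_def by auto

section \<open>Upper bound: reversing cycles by triangles\<close>

lemma triangle_k_cycle:
  assumes "distinct [a, b, c]"
  shows "k_cycle 3 {(a, b), (b, c), (c, a)}"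
  unfolding k_cycle_iff_zip using assms by (intro conjI exI[of _ "[a, b, c]"]) auto

lemma triangle_step:
  assumes "tournament I G" "distinct [a, b, c]" "{(a, b), (b, c), (c, a)} \<subseteq> G"
  shows "(G, G - {(a, b), (b, c), (c, a)} \<union> {(b, a), (c, b), (a, c)}) \<in> reversal_step I"
proof -
  have "{(a, b), (b, c), (c, a)}\<inverse> = {(b, a), (c, b), (a, c)}" by auto
  then show ?thesis
    using assms triangle_k_cycle[OF assms(2)] unfolding reversal_step_def by fastforce
qed

text \<open>The pair \<open>a\<close>, \<open>c\<close> is a chord cutting the cycle through
  \<open>a, b, c, zs\<close> into the triangle on \<open>a, b, c\<close> and a cycle with one vertex
  less. If the chord is \<open>(c, a)\<close>, the triangle can be reversed first, and this creates
  the edge \<open>(a, c)\<close> that closes the shorter cycle. If it is \<open>(a, c)\<close>, the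
  shorter cycle is reversed first, and this creates the edge that closes the triangle. Either way
  the chord is reversed twice and ends as it began.\<close>

lemma reverse_cycle_list:
  assumes "tournament I G" "distinct xs" "length xs = n + 3" "set (zip xs (rotate1 xs)) \<subseteq> G"
  shows "(G, G - set (zip xs (rotate1 xs)) \<union> (set (zip xs (rotate1 xs)))\<inverse>)
           \<in> reversal_step I ^^ (n + 1)"
  using assms
proof (induction n arbitrary: xs G)
  case 0
  then have "k_cycle 3 (set (zip xs (rotate1 xs)))"
    unfolding k_cycle_iff_zip by auto
  with 0 show ?case by (auto simp: reversal_step_def)
next
  case (Suc n)
  then obtain a b c zs where xs: "xs = a # b # c # zs" and len: "length zs = n + 1"
    by (auto simp: length_Suc_conv numeral_3_eq_3)
  \<comment> \<open>\<open>E\<close> is the path from \<open>c\<close> through \<open>zs\<close>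
    back to \<open>a\<close>, common to the long cycle and the shortened one.\<close>
  define E where "E = set (zip (c # zs) (zs @ [a]))"
  have C: "set (zip xs (rotate1 xs)) = {(a, b), (b, c)} \<union> E"
    by (simp add: xs E_def)
  have C': "set (zip (a # c # zs) (rotate1 (a # c # zs))) = {(a, c)} \<union> E"
    by (simp add: E_def)
  have d: "distinct [a, b, c]" "distinct (a # c # zs)" "b \<notin> set zs"
    using Suc.prems xs by auto
  have E_sub: "E \<subseteq> (set (c # zs)) \<times> set (zs @ [a])"
    unfolding E_def by (auto dest: set_zip_leftD set_zip_rightD simp del: zip_Cons)
  \<comment> \<open>As \<open>zs\<close> is nonempty, the last edge of the path \<open>E\<close>
    starts in \<open>zs\<close> and not at \<open>c\<close>; hence the chord is not itself an edge
    of \<open>E\<close>.\<close>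
  obtain z zs' where z: "zs = z # zs'" using len by (cases zs) auto
  have "(c, a) \<notin> E"
    using d z E_def by (auto dest: set_zip_leftD)
  with E_sub d have E: "(c, a) \<notin> E" "(a, c) \<notin> E" "(u, b) \<notin> E" "(b, u) \<notin> E" for u
    by auto
  have G: "(a, b) \<in> G" "(b, c) \<in> G" "E \<subseteq> G"
    using Suc.prems C by auto
  have "asym G" using Suc.prems tournament_asym by blast
  then have as: "(y, x) \<notin> G" if "(x, y) \<in> G" for x y
    using that by (rule asymD)
  have as_E: "(y, x) \<notin> E" if "(x, y) \<in> G" for x y
    using as[OF that] G by blast
  have IH: "(H, H - ({(a, c)} \<union> E) \<union> ({(a, c)} \<union> E)\<inverse>) \<in> reversal_step I ^^ (n + 1)"
    if "tournament I H" "{(a, c)} \<union> E \<subseteq> H" for H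
    using Suc.IH[OF that(1) d(2)] that(2) len unfolding C' by simp
  show ?case
  proof (cases "(c, a) \<in> G")
    case True
    let ?T = "{(a, b), (b, c), (c, a)}"
    let ?H = "G - ?T \<union> {(b, a), (c, b), (a, c)}"
    have step: "(G, ?H) \<in> reversal_step I"
      using Suc.prems d G True by (intro triangle_step) auto
    have "{(b, a), (c, b), (a, c)} = ?T\<inverse>" by auto
    then have "tournament I ?H"
      using Suc.prems(1) G True by (metis empty_subsetI insert_subset tournament_reverse)
    moreover have "{(a, c)} \<union> E \<subseteq> ?H" using E G by auto
    ultimately have rest: "(?H, ?H - ({(a, c)} \<union> E) \<union> ({(a, c)} \<union> E)\<inverse>) \<in> reversal_step I ^^ (n + 1)"
      by (rule IH)
    have "?H - ({(a, c)} \<union> E) \<union> ({(a, c)} \<union> E)\<inverse>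
        = G - ({(a, b), (b, c)} \<union> E) \<union> ({(a, b), (b, c)} \<union> E)\<inverse>"
      using E as as_E G True by auto
    with relpow_Suc_I2[OF step rest] show ?thesis
      unfolding C by simp
  next
    case False
    have "a \<in> I" "c \<in> I" "a \<noteq> c"
      using tournament_edgeD[OF Suc.prems(1)] G d by auto
    with False have ac: "(a, c) \<in> G"
      using tournament_iff[OF Suc.prems(1)] by blast
    let ?H = "G - ({(a, c)} \<union> E) \<union> ({(a, c)} \<union> E)\<inverse>"
    have rest: "(G, ?H) \<in> reversal_step I ^^ (n + 1)"
      using Suc.prems(1) ac G by (intro IH) auto
    have "tournament I ?H"
      using Suc.prems(1) ac G by (intro tournament_reverse) auto
    moreover have "{(a, b), (b, c), (c, a)} \<subseteq> ?H"
      using E G d by auto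
    ultimately have step: "(?H, ?H - {(a, b), (b, c), (c, a)} \<union> {(b, a), (c, b), (a, c)}) \<in> reversal_step I"
      using d(1) by (intro triangle_step)
    have "?H - {(a, b), (b, c), (c, a)} \<union> {(b, a), (c, b), (a, c)}
        = G - ({(a, b), (b, c)} \<union> E) \<union> ({(a, b), (b, c)} \<union> E)\<inverse>"
      using E as as_E G d ac by auto
    with relpow_Suc_I[OF rest step] show ?thesis
      unfolding C by simp
  qed
qed

lemma reverse_k_cycle:
  assumes "tournament I G" "k_cycle k C" "C \<subseteq> G"
  shows "(G, G - C \<union> C\<inverse>) \<in> reversal_step I ^^ (k - 2)"
proof -
  obtain xs where xs: "k \<ge> 3" "length xs = k" "distinct xs" "C = set (zip xs (rotate1 xs))"
    using assms(2) by (rule k_cycleE)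
  then have "k - 2 = k - 3 + 1" by simp
  with reverse_cycle_list[OF assms(1) xs(3), of "k - 3"] xs assms(3) show ?thesis
    by simp
qed

text \<open>The cycles are reversed one after another, a \<open>k\<close>-cycle in
  \<open>k - 2\<close> steps. The count is stated additively to avoid truncated subtraction.\<close>

lemma reverse_cycle_decomposition:
  assumes "finite F" "cycle_decomposition D F" "tournament I G" "D \<subseteq> G"
  shows "\<exists>n. (G, G - D \<union> D\<inverse>) \<in> reversal_step I ^^ n \<and> n + 2 * card F = card D"
  using assms
proof (induction F arbitrary: D G rule: finite_induct)
  case empty
  then show ?case by (auto simp: cycle_decomposition_def)
next
  case (insert C F)
  define U where "U = \<Union>F"
  have D: "D = C \<union> U" and dec: "cycle_decomposition U F" and CU: "C \<inter> U = {}"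
    using insert.prems insert.hyps
    by (auto simp: cycle_decomposition_def U_def pairwise_insert disjnt_def)
  obtain k where k: "k_cycle k C"
    using insert.prems by (auto simp: cycle_decomposition_def)
  have G: "C \<subseteq> G" "U \<subseteq> G" using insert.prems D by auto
  have fin: "finite C" "finite U"
    using k k_cycle_finite cycle_decomposition_eulerian[OF dec insert.hyps(1)]
    by (auto simp: eulerian_def)
  let ?H = "G - C \<union> C\<inverse>"
  have 1: "(G, ?H) \<in> reversal_step I ^^ (k - 2)"
    using insert.prems(2) k G by (intro reverse_k_cycle)
  have "tournament I ?H" using insert.prems(2) G by (intro tournament_reverse)
  moreover have "U \<subseteq> ?H" using G CU by auto
  ultimately obtain n where n: "(?H, ?H - U \<union> U\<inverse>) \<in> reversal_step I ^^ n" "n + 2 * card F = card U"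
    using insert.IH dec by blast
  have "asym G" using insert.prems tournament_asym by blast
  \<comment> \<open>Reversing the remaining cycles must not undo the reversal of
    \<open>C\<close>.\<close>
  then have "C\<inverse> \<inter> U = {}" using G by (auto dest: asymD)
  then have "?H - U \<union> U\<inverse> = G - D \<union> D\<inverse>" using D by auto
  then have "(G, G - D \<union> D\<inverse>) \<in> reversal_step I ^^ (k - 2 + n)"
    using 1 n by (auto simp: relpow_add)
  moreover have "card D = k + card U"
    using k_cycle_card[OF k] D CU fin by (simp add: card_Un_disjoint)
  then have "k - 2 + n + 2 * card (insert C F) = card D"
    using n(2) k insert.hyps unfolding k_cycle_def by simp arith
  ultimately show ?case by blast
qed

section \<open>Difference digraphs and scores\<close>

lemma asym_diff_digraph: "asym G \<Longrightarrow> asym (diff_digraph G P)"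
  unfolding diff_digraph_def by (auto intro!: asymI dest: asymD)

text \<open>\<open>G\<close> is the disjoint union of the difference \<open>D\<close> and
  \<open>G \<inter> P\<close>, while \<open>P\<close> is that of \<open>D\<inverse>\<close> and
  \<open>G \<inter> P\<close>. The common part adds the same amount to both scores of a vertex, so
  equal scores make its out-degrees in \<open>D\<close> and \<open>D\<inverse>\<close>
  equal.\<close>

lemma eulerian_diff_digraph:
  assumes "finite I" "tournament I P" "tournament I G" "same_scores I P G"
  shows "eulerian (diff_digraph G P)"
proof -
  let ?D = "diff_digraph G P"
  have fin: "finite G" "finite P" using assms tournament_finite by auto
  have sub: "?D \<subseteq> G" "?D\<inverse> \<subseteq> P" by (auto simp: diff_digraph_def)
  then have finD: "finite ?D" using fin finite_subset by blast
  have aG: "asym G" and aP: "asym P" using assms tournament_asym by auto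
  have "(x, y) \<in> G \<Longrightarrow> (x, y) \<in> P \<or> (y, x) \<in> P" for x y
    using assms(2,3) by (metis tournament_iff tournament_edgeD)
  then have G: "G = ?D \<union> G \<inter> P" by (auto simp: diff_digraph_def)
  have "(x, y) \<in> P \<Longrightarrow> (x, y) \<in> G \<or> (y, x) \<in> G" for x y
    using assms(2,3) by (metis tournament_iff tournament_edgeD)
  then have P: "P = ?D\<inverse> \<union> G \<inter> P" by (auto simp: diff_digraph_def)
  have "card (?D `` {v}) = card (?D\<inverse> `` {v})" for v
  proof (cases "v \<in> I")
    case True
    have "?D \<inter> (G \<inter> P) = {}" using aP by (auto simp: diff_digraph_def dest: asymD)
    then have "card (G `` {v}) = card (?D `` {v}) + card ((G \<inter> P) `` {v})"
      using G card_Image_Un finD fin by (metis finite_Int)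
    moreover have "?D\<inverse> \<inter> (G \<inter> P) = {}" using aG by (auto simp: diff_digraph_def dest: asymD)
    then have "card (P `` {v}) = card (?D\<inverse> `` {v}) + card ((G \<inter> P) `` {v})"
      using P card_Image_Un finD fin by (metis finite_Int finite_converse)
    ultimately show ?thesis
      using assms(4) True by (simp add: same_scores_def)
  next
    case False
    then have "?D `` {v} = {}" "?D\<inverse> `` {v} = {}"
      using sub assms(2,3) by (auto simp: tournament_def)
    then show ?thesis by simp
  qed
  with finD show ?thesis by (simp add: eulerian_def)
qed

text \<open>At each vertex, reversal trades the out-edges in \<open>C\<close> for its in-edges in
  \<open>C\<close>, and these are equally many.\<close>

lemma same_scores_reverse:
  assumes "finite I" "tournament I G" "eulerian C" "C \<subseteq> G"
  shows "same_scores I (G - C \<union> C\<inverse>) G"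
  unfolding same_scores_def
proof
  fix v
  have fin: "finite G" "finite C" using assms tournament_finite finite_subset by blast+
  have "asym G" using assms tournament_asym by blast
  then have "(G - C) \<inter> C\<inverse> = {}" using assms(4) by (auto dest: asymD)
  then have "card ((G - C \<union> C\<inverse>) `` {v}) = card ((G - C) `` {v}) + card (C\<inverse> `` {v})"
    using fin by (intro card_Image_Un) auto
  also have "card (C\<inverse> `` {v}) = card (C `` {v})"
    using assms(3) by (simp add: eulerian_def)
  also have "card ((G - C) `` {v}) + card (C `` {v}) = card ((G - C \<union> C) `` {v})"
    using fin by (intro card_Image_Un[symmetric]) auto
  also have "G - C \<union> C = G" using assms(4) by blast
  finally show "card ((G - C \<union> C\<inverse>) `` {v}) = card (G `` {v})" .
qed

section \<open>Lower bound: the effect of one step\<close>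

lemma card_meeting_le:
  assumes "pairwise disjnt F" "finite K"
  shows "card {A \<in> F. A \<inter> K \<noteq> {}} \<le> card K"
proof -
  \<comment> \<open>By disjointness an edge lies in at most one member of \<open>F\<close>, so
    \<open>?g\<close> hits every member that meets \<open>K\<close>. Its arbitrary value on edges
    outside all members does no harm, as only covering is needed.\<close>
  let ?g = "\<lambda>e. SOME A. A \<in> F \<and> e \<in> A"
  have "A \<in> ?g ` K" if A: "A \<in> F" "A \<inter> K \<noteq> {}" for A
  proof -
    obtain e where e: "e \<in> A" "e \<in> K" using A by blast
    have "?g e = A"
      using assms(1) A(1) e(1) by (intro some_equality) (auto simp: pairwise_def disjnt_def)
    with e show ?thesis by blast
  qed
  then have "{A \<in> F. A \<inter> K \<noteq> {}} \<subseteq> ?g ` K" by blast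
  then show ?thesis
    using assms(2) by (meson card_image_le card_mono finite_imageI order_trans)
qed

text \<open>Let \<open>D\<close> and \<open>D'\<close> be the difference digraphs before and after
  the step, and let d be the number of edges of \<open>C\<close> in \<open>D\<close>. Then
  \<open>D'\<close> has 3 - 2d more edges than \<open>D\<close>, so the claim amounts to: the span
  of \<open>D'\<close> is at most the span of \<open>D\<close> plus 2 - d.\<close>

lemma beta_step:
  assumes "finite I" "tournament I P" "tournament I G" "same_scores I P G"
    and C: "k_cycle 3 C" "C \<subseteq> G"
  shows "beta (diff_digraph G P) \<le> beta (diff_digraph (G - C \<union> C\<inverse>) P) + 1"
proof -
  define H where "H = G - C \<union> C\<inverse>"
  define D where "D = diff_digraph G P"
  define D' where "D' = diff_digraph H P"
  \<comment> \<open>On the triangle edges outside \<open>D\<close> the tournaments \<open>G\<close>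
    and \<open>P\<close> agree, so reversing them creates new differences. These are the edges in
    \<open>K\<close>; the triangle edges in \<open>D\<close> cease to be differences.\<close>
  define K where "K = (C - D)\<inverse>"
  have tH: "tournament I H"
    unfolding H_def using assms by (intro tournament_reverse)
  have "same_scores I H G"
    unfolding H_def using assms eulerian_k_cycle by (intro same_scores_reverse)
  then have "same_scores I P H" using assms(4) by (simp add: same_scores_def)
  then have eD': "eulerian D'"
    unfolding D'_def using assms tH by (intro eulerian_diff_digraph)
  have eD: "eulerian D"
    unfolding D_def using assms by (intro eulerian_diff_digraph)
  have aG: "asym G" and aD: "asym D" and aD': "asym D'"
    unfolding D_def D'_def using assms tH tournament_asym asym_diff_digraph by blast+
  have fin: "finite D" "finite D'" "finite C"
    using eD eD' C k_cycle_finite by (auto simp: eulerian_def)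
  then have finK: "finite K" by (simp add: K_def)
  have DG: "D \<subseteq> G" by (auto simp: D_def diff_digraph_def)
  have CP: "(x, y) \<in> P" if "(x, y) \<in> C - D" for x y
  proof -
    have "(x, y) \<in> G" "(y, x) \<notin> P"
      using that C(2) by (auto simp: D_def diff_digraph_def)
    then show ?thesis using assms(2,3) by (metis tournament_iff tournament_edgeD)
  qed
  have "asym P" using assms tournament_asym by blast
  then have "D' = (D - C) \<union> K"
    using CP by (auto simp: D_def D'_def H_def K_def diff_digraph_def dest: asymD)
  moreover have DK: "D \<inter> K = {}"
    using DG C(2) aG by (auto simp: K_def dest: asymD)
  ultimately have D': "D' = (D - C) \<union> K" "(D - C) \<inter> K = {}" by auto
  have cK: "card K + card (C \<inter> D) = 3"
  proof -
    have "card K = card (C - D)" by (simp add: K_def)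
    moreover have "card C = card (C \<inter> D) + card (C - D)"
      using fin by (metis Int_Diff_Un Int_Diff_disjoint card_Un_disjoint finite_Diff finite_Int)
    ultimately show ?thesis using k_cycle_card[OF C(1)] by simp
  qed
  have cD: "card D' + card (C \<inter> D) = card D + card K"
  proof -
    have "card D' = card (D - C) + card K"
      using D' fin finK by (simp add: card_Un_disjoint)
    moreover have "card D = card (D \<inter> C) + card (D - C)"
      using fin by (metis Int_Diff_Un Int_Diff_disjoint card_Un_disjoint finite_Diff finite_Int)
    ultimately show ?thesis by (simp add: Int_commute)
  qed
  obtain F where F: "cycle_decomposition D' F" "card F = eulerian_span D'"
    using eD' aD' by (rule eulerian_span_attained)
  have finF: "finite F" using F fin cycle_decomposition_finite by blast
  define F1 where "F1 = {A \<in> F. A \<inter> K \<noteq> {}}"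
  define F2 where "F2 = F - F1"
  have cF: "card F = card F1 + card F2"
    using finF by (simp add: F1_def F2_def card_Diff_subset card_mono)
  have cF1: "card F1 \<le> card K"
    unfolding F1_def using F finK
    by (intro card_meeting_le) (auto simp: cycle_decomposition_def)
  \<comment> \<open>The members of \<open>F2\<close> avoid \<open>K\<close> and survive as cycles of
    \<open>D - C\<close>. \<open>R\<close> is the rest of \<open>D\<close>, and a decomposition of
    it completes \<open>F2\<close> to one of \<open>D\<close>.\<close>
  define R where "R = D - \<Union>F2"
  have dec2: "cycle_decomposition (\<Union>F2) F2"
    using F by (auto simp: cycle_decomposition_def F2_def pairwise_def)
  have F2_sub: "\<Union>F2 \<subseteq> D - C"
  proof
    fix e assume "e \<in> \<Union>F2"
    then have "e \<in> D'" "e \<notin> K"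
      using F(1) by (auto simp: cycle_decomposition_def F2_def F1_def)
    with D' show "e \<in> D - C" by blast
  qed
  have "eulerian (\<Union>F2)"
    using dec2 finF by (auto simp: F2_def intro: cycle_decomposition_eulerian)
  then have "eulerian R"
    unfolding R_def using eD F2_sub by (intro eulerian_Diff) auto
  moreover have "asym R" using aD by (auto simp: R_def intro!: asymI dest: asymD)
  ultimately obtain J where J: "cycle_decomposition R J"
    using cycle_decomposition_exists by blast
  have finJ: "finite J" using J fin cycle_decomposition_finite by (auto simp: R_def)
  have "\<Union>F2 \<union> R = D" using F2_sub by (auto simp: R_def)
  moreover have "\<Union>F2 \<inter> R = {}" by (auto simp: R_def)
  ultimately have "cycle_decomposition D (F2 \<union> J)" "F2 \<inter> J = {}"
    using cycle_decomposition_Un[OF dec2 J] by auto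
  then have span: "card F2 + card J \<le> eulerian_span D"
    using card_le_eulerian_span[OF fin(1), of "F2 \<union> J"] finF finJ
    by (simp add: card_Un_disjoint F2_def)
  \<comment> \<open>\<open>F1\<close> counts the cycles lost and \<open>J\<close> those regained, so
    this is the required comparison of spans. If \<open>R\<close> is nonempty, one regained cycle
    suffices, as \<open>F1\<close> has at most 3 - d members.\<close>
  have "card F1 + card (C \<inter> D) \<le> card J + 2"
  proof (cases "R = {}")
    case False
    then have "J \<noteq> {}" using J by (auto simp: cycle_decomposition_def)
    then have "card J \<ge> 1" using finJ by (simp add: Suc_le_eq card_gt_0_iff)
    then show ?thesis using cF1 cK by simp
  next
    case True
    then have "D = \<Union>F2" using F2_sub by (auto simp: R_def)
    with F2_sub have CD: "C \<inter> D = {}" by blast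
    \<comment> \<open>Here \<open>D\<close> is exhausted by \<open>F2\<close>, so a cycle in
      \<open>F1\<close> lies inside \<open>K\<close>. Since \<open>K\<close> now has three edges and
      a cycle has at least three, they coincide.\<close>
    have "A = K" if "A \<in> F1" for A
    proof -
      have A: "A \<in> F" using that by (simp add: F1_def)
      then obtain k where k: "k_cycle k A"
        using F(1) by (auto simp: cycle_decomposition_def)
      have "A \<inter> B = {}" if "B \<in> F2" for B
      proof -
        have "B \<in> F" "A \<noteq> B"
          using that \<open>A \<in> F1\<close> by (auto simp: F2_def)
        with A F(1) have "disjnt A B"
          unfolding cycle_decomposition_def by (meson pairwiseD)
        then show ?thesis by (simp add: disjnt_def)
      qed
      then have "A \<inter> \<Union>F2 = {}" by blast
      moreover have "A \<subseteq> D'" using F(1) A by (auto simp: cycle_decomposition_def)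
      ultimately have "A \<subseteq> K" using D' \<open>D = \<Union>F2\<close> by blast
      moreover have "card K \<le> card A"
        using k_cycle_card[OF k] k cK by (simp add: k_cycle_def)
      ultimately show ?thesis using finK card_seteq by blast
    qed
    then have "F1 \<subseteq> {K}" by blast
    then have "card F1 \<le> card {K}" by (intro card_mono) auto
    with CD show ?thesis by simp
  qed
  then have "beta D \<le> beta D' + 1"
    using cF F(2) span cK cD unfolding beta_def by linarith
  then show ?thesis by (simp add: D_def D'_def H_def)
qed

text \<open>Every step keeps a tournament with the scores of \<open>P\<close>, so the bound for one
  step applies along the whole sequence; at its end the difference digraph is empty and
  \<open>beta\<close> is 0.\<close>

lemma beta_le_steps:
  assumes "(G, P) \<in> reversal_step I ^^ n"
    and "finite I" "tournament I P" "tournament I G" "same_scores I P G"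
  shows "beta (diff_digraph G P) \<le> int n"
  using assms
proof (induction n arbitrary: G)
  case 0
  then have "asym G" "G = P" using tournament_asym by auto
  then have "diff_digraph G P = {}"
    by (auto simp: diff_digraph_def dest: asymD)
  then show ?case by (simp add: beta_def eulerian_span_empty)
next
  case (Suc n)
  obtain H where H: "(G, H) \<in> reversal_step I" "(H, P) \<in> reversal_step I ^^ n"
    using Suc.prems(1) by (meson relpow_Suc_D2)
  obtain C where C: "k_cycle 3 C" "C \<subseteq> G" "H = G - C \<union> C\<inverse>"
    using H(1) by (rule reversal_stepD)
  have "tournament I H"
    using C Suc.prems by (auto intro: tournament_reverse)
  moreover have "same_scores I H G"
    using C Suc.prems eulerian_k_cycle by (auto intro: same_scores_reverse)
  then have "same_scores I P H" using Suc.prems by (simp add: same_scores_def)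
  ultimately have "beta (diff_digraph H P) \<le> int n"
    using H Suc by blast
  moreover have "beta (diff_digraph G P) \<le> beta (diff_digraph H P) + 1"
    using C Suc.prems beta_step by blast
  ultimately show ?case by simp
qed

theorem corollary4p8:
  fixes I :: "'a set" and \<Pi> \<Gamma> :: "'a rel"
  assumes "finite I"
    and "tournament I \<Pi>" and "tournament I \<Gamma>"
    and "same_scores I \<Pi> \<Gamma>"
  shows "(\<exists>n. (\<Gamma>, \<Pi>) \<in> reversal_step I ^^ n) \<and>
         int (LEAST n. (\<Gamma>, \<Pi>) \<in> reversal_step I ^^ n) = beta (diff_digraph \<Gamma> \<Pi>)"
proof -
  let ?D = "diff_digraph \<Gamma> \<Pi>"
  have e: "eulerian ?D" using assms by (rule eulerian_diff_digraph)
  have "asym ?D" using assms tournament_asym asym_diff_digraph by blast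
  with e obtain F where F: "cycle_decomposition ?D F" "card F = eulerian_span ?D"
    by (rule eulerian_span_attained)
  have sub: "?D \<subseteq> \<Gamma>" by (auto simp: diff_digraph_def)
  have "finite F" using F e cycle_decomposition_finite by (auto simp: eulerian_def)
  then obtain n where n: "(\<Gamma>, \<Gamma> - ?D \<union> ?D\<inverse>) \<in> reversal_step I ^^ n" "n + 2 * card F = card ?D"
    using reverse_cycle_decomposition F(1) assms(3) sub by blast
  \<comment> \<open>Outside \<open>?D\<close> and its converse the two tournaments agree, so
    reversing \<open>?D\<close> turns \<open>\<Gamma>\<close> into \<open>\<Pi>\<close>.\<close>
  have "(x, y) \<in> \<Gamma> - ?D \<union> ?D\<inverse> \<longleftrightarrow> (x, y) \<in> \<Pi>" for x y
    using assms(2,3) by (auto simp: diff_digraph_def) (metis tournament_iff tournament_edgeD)+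
  then have "\<Gamma> - ?D \<union> ?D\<inverse> = \<Pi>" by auto
  with n have step: "(\<Gamma>, \<Pi>) \<in> reversal_step I ^^ n" by simp
  have n_eq: "int n = beta ?D" using n(2) F(2) by (simp add: beta_def)
  have "(LEAST m. (\<Gamma>, \<Pi>) \<in> reversal_step I ^^ m) = n"
  proof (rule Least_equality)
    show "(\<Gamma>, \<Pi>) \<in> reversal_step I ^^ n" by (fact step)
  next
    fix m assume "(\<Gamma>, \<Pi>) \<in> reversal_step I ^^ m"
    from beta_le_steps[OF this assms] n_eq show "n \<le> m" by simp
  qed
  with step n_eq show ?thesis by metis
qed

end
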